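(* Let $f,g:S^1\times[0,\infty)\to(0,\infty)$ be smooth positive functions such that the metrics $f^2dx^2+g^2(dy^2+\cos^2y\,dz^2)$ on $S^1\times S^2$ solve the cross curvature flow $\frac{\partial}{\partial t}g_{ij}=-2h_{ij}$. Write $\frac{\partial}{\partial s}=\frac1f\frac{\partial}{\partial x}$ and assume $\max_{S^1}\left|\frac{\partial g}{\partial s}(\cdot,0)\right|\le\frac14$. Then there is a constant $\alpha>0$ such that $g(\cdot,t)$ converges (uniformly on $S^1$) to $\alpha$ as $t\to\infty$.
   Context: For a Riemannian 3-manifold with metric $g_{ij}$, let $P^{ij}=g^{ik}g^{jl}R_{kl}-\frac12Rg^{ij}$ and let the cross curvature tensor be $h_{ij}=\frac{\det P^{kl}}{\det g^{kl}}V_{ij}$, where $V_{ij}$ is the inverse of $P^{ij}$ (with $(\det P^{kl})V_{ij}$ interpreted as the adjugate matrix of $P^{ij}$ when $P^{ij}$ is not invertible). Here $x$ is a coordinate on the orbit circle $S^1$, and $dy^2+\cos^2y\,dz^2$ is the round metric of the unit sphere $S^2$. With $\frac{\partial}{\partial s}=\frac1f\frac{\partial}{\partial x}$, the flow $\frac{\partial}{\partial t}g_{ij}=-2h_{ij}$ for these metrics is equivalent to $\frac{\partial f}{\partial t}=-\frac{f}{g^2}\left(\frac{\partial^2g}{\partial s^2}\right)^2$, $\frac{\partial g}{\partial t}=\frac1{g^2}\left[1-\left(\frac{\partial g}{\partial s}\right)^2\right]\frac{\partial^2g}{\partial s^2}$. *)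

theory Defs
  imports "HOL-Analysis.Analysis"
begin

section \<open>Tensor calculus of a metric in a coordinate chart\<close>

type_synonym metric3 = "real^3 \<Rightarrow> real^3^3"

definition pderiv_dir :: "3 \<Rightarrow> (real^3 \<Rightarrow> real) \<Rightarrow> real^3 \<Rightarrow> real" where
  "pderiv_dir k u p = deriv (\<lambda>s. u (p + s *\<^sub>R axis k 1)) 0"

definition inv_metric :: "metric3 \<Rightarrow> metric3" where
  "inv_metric G p = matrix_inv (G p)"

text \<open>\<open>christoffel G k i j\<close> is $\Gamma^k_{ij}$ of the Levi-Civita connection.\<close>
definition christoffel :: "metric3 \<Rightarrow> 3 \<Rightarrow> 3 \<Rightarrow> 3 \<Rightarrow> real^3 \<Rightarrow> real" where
  "christoffel G k i j p =
     (1/2) * (\<Sum>l\<in>UNIV. inv_metric G p $ k $ l *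
       (pderiv_dir i (\<lambda>q. G q $ j $ l) p + pderiv_dir j (\<lambda>q. G q $ i $ l) p
        - pderiv_dir l (\<lambda>q. G q $ i $ j) p))"

text \<open>\<open>riemann G l k i j\<close> is the $\partial_l$-component of
  $\nabla_i \nabla_j \partial_k - \nabla_j \nabla_i \partial_k$; with this convention the
  Ricci tensor of a round sphere is positive.\<close>
definition riemann :: "metric3 \<Rightarrow> 3 \<Rightarrow> 3 \<Rightarrow> 3 \<Rightarrow> 3 \<Rightarrow> real^3 \<Rightarrow> real" where
  "riemann G l k i j p =
     pderiv_dir i (christoffel G l j k) p - pderiv_dir j (christoffel G l i k) p
     + (\<Sum>m\<in>UNIV. christoffel G l i m p * christoffel G m j k p
                  - christoffel G l j m p * christoffel G m i k p)"

definition ricci :: "metric3 \<Rightarrow> real^3 \<Rightarrow> real^3^3" where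
  "ricci G p = (\<chi> k j. \<Sum>i\<in>UNIV. riemann G i k i j p)"

definition scalar_curvature :: "metric3 \<Rightarrow> real^3 \<Rightarrow> real" where
  "scalar_curvature G p = (\<Sum>i\<in>UNIV. \<Sum>j\<in>UNIV. inv_metric G p $ i $ j * ricci G p $ i $ j)"

definition P_tensor :: "metric3 \<Rightarrow> real^3 \<Rightarrow> real^3^3" where
  "P_tensor G p = (\<chi> i j.
     (\<Sum>k\<in>UNIV. \<Sum>l\<in>UNIV. inv_metric G p $ i $ k * inv_metric G p $ j $ l * ricci G p $ k $ l)
     - (1/2) * scalar_curvature G p * inv_metric G p $ i $ j)"

text \<open>Entry $(i,j)$ of the adjugate is the $(j,i)$ cofactor, i.e. the determinant of the matrix
  whose row $j$ has been replaced by the $i$-th unit vector.\<close>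
definition adjugate3 :: "real^3^3 \<Rightarrow> real^3^3" where
  "adjugate3 A = (\<chi> i j. det (\<chi> k. if k = j then axis i 1 else A $ k))"

definition cross_curvature :: "metric3 \<Rightarrow> real^3 \<Rightarrow> real^3^3" where
  "cross_curvature G p =
     (if invertible (P_tensor G p)
      then (det (P_tensor G p) / det (inv_metric G p)) *\<^sub>R matrix_inv (P_tensor G p)
      else (1 / det (inv_metric G p)) *\<^sub>R adjugate3 (P_tensor G p))"

text \<open>The flow $\partial_t g_{ij} = -2 h_{ij}$ on a coordinate domain \<open>U\<close> for all times
  $t \ge 0$ (the time derivative at $t = 0$ is one-sided).\<close>
definition cross_curvature_flow_on :: "(real^3) set \<Rightarrow> (real \<Rightarrow> metric3) \<Rightarrow> bool" where
  "cross_curvature_flow_on U G \<longleftrightarrow>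
     (\<forall>t\<ge>0. \<forall>p\<in>U. \<forall>i j.
        ((\<lambda>\<tau>. G \<tau> p $ i $ j) has_real_derivative - 2 * cross_curvature (G t) p $ i $ j)
          (at t within {0..}))"


section \<open>Rotationally symmetric metrics on the product of a circle and a sphere\<close>

text \<open>The circle is the unit circle \<open>sphere 0 1\<close> in the complex plane, with angular
  coordinate \<open>x\<close> corresponding to the point \<open>cis x\<close>. A function on the circle times
  $[0,\infty)$ has type \<open>complex \<Rightarrow> real \<Rightarrow> real\<close>; its values at other
  arguments are irrelevant.

  Smoothness up to and including $t = 0$: \<open>D i j\<close> is
  $\partial_x^i \partial_t^j u$, and all of these exist and are jointly continuous.\<close>
definition smooth_circle_time :: "(complex \<Rightarrow> real \<Rightarrow> real) \<Rightarrow> bool" where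
  "smooth_circle_time u \<longleftrightarrow>
     (\<exists>D :: nat \<Rightarrow> nat \<Rightarrow> real \<Rightarrow> real \<Rightarrow> real.
        (\<forall>x. \<forall>t\<ge>0. D 0 0 x t = u (cis x) t) \<and>
        (\<forall>i j. continuous_on (UNIV \<times> {0..}) (\<lambda>(x, t). D i j x t)) \<and>
        (\<forall>i j x. \<forall>t\<ge>0.
           ((\<lambda>\<xi>. D i j \<xi> t) has_real_derivative D (Suc i) j x t) (at x) \<and>
           ((\<lambda>\<tau>. D i j x \<tau>) has_real_derivative D i (Suc j) x t) (at t within {0..})))"

text \<open>Coordinates are \<open>p = (x, y, z)\<close>, with latitude \<open>y\<close> and longitude \<open>z\<close> on the unit
  sphere. Letting \<open>x\<close> and \<open>z\<close> range over all reals, the chart domain covers everything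
  except the two poles of each sphere.\<close>
definition warped_metric ::
    "(complex \<Rightarrow> real \<Rightarrow> real) \<Rightarrow> (complex \<Rightarrow> real \<Rightarrow> real) \<Rightarrow> real \<Rightarrow> metric3" where
  "warped_metric f g t p = (\<chi> i j.
     if i \<noteq> j then 0
     else if i = 1 then (f (cis (p $ 1)) t)\<^sup>2
     else if i = 2 then (g (cis (p $ 1)) t)\<^sup>2
     else (g (cis (p $ 1)) t)\<^sup>2 * (cos (p $ 2))\<^sup>2)"

definition chart_domain :: "(real^3) set" where
  "chart_domain = {p. - (pi/2) < p $ 2 \<and> p $ 2 < pi/2}"

text \<open>$\partial u / \partial s = f^{-1}\, \partial u / \partial x$ at the point \<open>cis x\<close>.\<close>
definition arclength_deriv ::
    "(complex \<Rightarrow> real \<Rightarrow> real) \<Rightarrow> (complex \<Rightarrow> real \<Rightarrow> real) \<Rightarrow> real \<Rightarrow> real \<Rightarrow> real" where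
  "arclength_deriv f u x t = (1 / f (cis x) t) * deriv (\<lambda>\<xi>. u (cis \<xi>) t) x"

end

theory Submission
  imports Defs
begin

text \<open>
  Write $g_s$ for the arclength derivative $f^{-1} g_x$ and $g_{ss}$ for $f^{-1} (g_s)_x$.
  Computing the curvature of the metric turns the flow into
  $f_t = - f (g_{ss}/g)^2$ and $g_t = (1 - g_s^2)\, g_{ss} / g^2$.

  At a spatial critical point of $g$ the second equation reads $g_t = g_{xx}/(fg)^2$, so by the
  maximum principle $\max g(\cdot,t)$ is nonincreasing and $\min g(\cdot,t)$ is nondecreasing
  (lemmas \<open>upper_bound_preserved\<close> and \<open>lower_bound_preserved\<close>). Hence $g$ takes values in a
  compact subinterval $[m,K]$ of $(0,\infty)$, and it suffices to find times at which
  $\max g - \min g$ is arbitrarily small: monotonicity does the rest, and the limit is at least $m$.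

  Such times come from the first equation. The length $L(t) = \int f\,dx$ of the circle satisfies
  $L' = -E$ with $E = \int (g_{ss}/g)^2 f\,dx$ (lemma \<open>len_deriv\<close>). As $L \ge 0$, the energy $E$
  cannot stay above a positive constant (lemma \<open>energy_small\<close>). At a time with $E \le \eta^2$,
  Rolle's theorem gives a zero of $g_s$, so that
  $|g_s| \le \int |g_{ss}| f\,dx \le K \int (\eta/2 + (g_{ss}/g)^2/(2\eta)) f\,dx \le K \eta (L+1)/2$, and
  $\max g - \min g \le L \max |g_s|$ is of order $\eta$ (lemma \<open>oscillation_le\<close>).
\<close>

section \<open>Diagonal matrices and partial derivatives\<close>

text \<open>The diagonal matrix with the given entries.\<close>
definition diag3 :: "real \<Rightarrow> real \<Rightarrow> real \<Rightarrow> real^3^3" where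
  "diag3 a b c = (\<chi> i j. if i \<noteq> j then 0 else if i = 1 then a else if i = 2 then b else c)"

lemma diag3_nth [simp]:
  "diag3 a b c $ 1 $ 1 = a" "diag3 a b c $ 2 $ 2 = b" "diag3 a b c $ 3 $ 3 = c"
  "i \<noteq> j \<Longrightarrow> diag3 a b c $ i $ j = 0"
  by (auto simp: diag3_def)

lemma det_diag3 [simp]: "det (diag3 a b c) = a * b * c"
  by (simp add: det_3)

lemma matrix_inv_eqI:
  fixes A B :: "real^'n^'n"
  assumes "A ** B = mat 1"
  shows "matrix_inv A = B"
proof -
  have "\<exists>B. A ** B = mat 1 \<and> B ** A = mat 1"
    using assms matrix_left_right_inverse by blast
  then have "A ** matrix_inv A = mat 1 \<and> matrix_inv A ** A = mat 1"
    unfolding matrix_inv_def by (rule someI_ex)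
  then show ?thesis
    using assms by (metis matrix_mul_assoc matrix_mul_lid matrix_mul_rid)
qed

lemma matrix_inv_diag3:
  assumes "a \<noteq> 0" "b \<noteq> 0" "c \<noteq> 0"
  shows "matrix_inv (diag3 a b c) = diag3 (1/a) (1/b) (1/c)"
  by (rule matrix_inv_eqI)
     (use assms in \<open>auto simp: matrix_matrix_mult_def vec_eq_iff sum_3 forall_3 mat_def\<close>)

lemma adjugate3_diag3: "adjugate3 (diag3 a b c) = diag3 (b*c) (a*c) (a*b)"
  by (auto simp: adjugate3_def vec_eq_iff forall_3 det_3 axis_def)

text \<open>Every metric component and every Christoffel symbol below is a product of a function of the
  first coordinate and a function of the second one, so this rule gives all partial
  derivatives that the curvature needs.\<close>
lemma pderiv_dir_prod:
  assumes a: "(a has_real_derivative a') (at (p$1))" and b: "(b has_real_derivative b') (at (p$2))"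
  shows "pderiv_dir k (\<lambda>q. a (q$1) * b (q$2)) p =
    (if k = 1 then a' * b (p$2) else if k = 2 then a (p$1) * b' else 0)"
proof -
  have a0: "((\<lambda>s. a (p$1 + s)) has_real_derivative a') (at 0)"
    using a DERIV_shift[of a a' 0 "p$1"] by (simp add: add.commute)
  have b0: "((\<lambda>s. b (p$2 + s)) has_real_derivative b') (at 0)"
    using b DERIV_shift[of b b' 0 "p$2"] by (simp add: add.commute)
  consider "k = 1" | "k = 2" | "k = 3" using exhaust_3 by blast
  then show ?thesis
    unfolding pderiv_dir_def
    by cases (auto simp: axis_def intro!: DERIV_imp_deriv derivative_eq_intros a0 b0)
qed

section \<open>Curvature of a warped product metric\<close>

text \<open>The metric $u(x)^2 dx^2 + v(x)^2 (dy^2 + \cos^2 y\, dz^2)$ for positive $u$ and $v$ on the real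
  line, with \<open>u1\<close>, \<open>u2\<close>, \<open>v1\<close>, \<open>v2\<close> the first and second derivatives of the two functions.\<close>
locale warped_product =
  fixes u u1 u2 v v1 v2 :: "real \<Rightarrow> real"
  assumes u_pos: "\<And>x. u x > 0" and v_pos: "\<And>x. v x > 0"
    and du: "\<And>x. (u has_real_derivative u1 x) (at x)"
    and du1: "\<And>x. (u1 has_real_derivative u2 x) (at x)"
    and dv: "\<And>x. (v has_real_derivative v1 x) (at x)"
    and dv1: "\<And>x. (v1 has_real_derivative v2 x) (at x)"
begin

definition metric :: metric3 where
  "metric p = diag3 ((u (p$1))\<^sup>2) ((v (p$1))\<^sup>2) ((v (p$1))\<^sup>2 * (cos (p$2))\<^sup>2)"

lemma u_neq [simp]: "u x \<noteq> 0" and v_neq [simp]: "v x \<noteq> 0"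
  using u_pos[of x] v_pos[of x] by auto

text \<open>The Christoffel symbol $\Gamma^k_{ij}$ at $(x,y,z)$ is \<open>rad k i j x * lat k i j y\<close>; the primed
  functions are the derivatives of the two factors. For the index triples of the
  symbols that vanish for every warped product, \<open>rad\<close> is \<open>0\<close>.\<close>
definition rad :: "3 \<Rightarrow> 3 \<Rightarrow> 3 \<Rightarrow> real \<Rightarrow> real" where
  "rad k i j x =
     (if k = 1 \<and> i = 1 \<and> j = 1 then u1 x / u x
      else if k = 1 \<and> i = j then - (v x * v1 x / (u x)\<^sup>2)
      else if k \<noteq> 1 \<and> (i = 1 \<and> j = k \<or> i = k \<and> j = 1) then v1 x / v x
      else if k = 2 \<and> i = 3 \<and> j = 3 then 1
      else if k = 3 \<and> (i = 2 \<and> j = 3 \<or> i = 3 \<and> j = 2) then 1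
      else 0)"

definition lat :: "3 \<Rightarrow> 3 \<Rightarrow> 3 \<Rightarrow> real \<Rightarrow> real" where
  "lat k i j y =
     (if k = 1 \<and> i = 3 \<and> j = 3 then (cos y)\<^sup>2
      else if k = 2 \<and> i = 3 \<and> j = 3 then sin y * cos y
      else if k = 3 \<and> (i = 2 \<and> j = 3 \<or> i = 3 \<and> j = 2) then - tan y
      else 1)"

definition rad' :: "3 \<Rightarrow> 3 \<Rightarrow> 3 \<Rightarrow> real \<Rightarrow> real" where
  "rad' k i j x =
     (if k = 1 \<and> i = 1 \<and> j = 1 then (u2 x * u x - u1 x * u1 x) / (u x * u x)
      else if k = 1 \<and> i = j then
        - (((v1 x * v1 x + v x * v2 x) * (u x)\<^sup>2 - v x * v1 x * (2 * u x * u1 x)) / ((u x)\<^sup>2 * (u x)\<^sup>2))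
      else if k \<noteq> 1 \<and> (i = 1 \<and> j = k \<or> i = k \<and> j = 1) then (v2 x * v x - v1 x * v1 x) / (v x * v x)
      else 0)"

definition lat' :: "3 \<Rightarrow> 3 \<Rightarrow> 3 \<Rightarrow> real \<Rightarrow> real" where
  "lat' k i j y =
     (if k = 1 \<and> i = 3 \<and> j = 3 then - (2 * cos y * sin y)
      else if k = 2 \<and> i = 3 \<and> j = 3 then (cos y)\<^sup>2 - (sin y)\<^sup>2
      else if k = 3 \<and> (i = 2 \<and> j = 3 \<or> i = 3 \<and> j = 2) then - (1 / (cos y)\<^sup>2)
      else 0)"

lemma rad_deriv: "(rad k i j has_real_derivative rad' k i j x) (at x)"
proof -
  have "((\<lambda>x. u1 x / u x) has_real_derivative (u2 x * u x - u1 x * u1 x) / (u x * u x)) (at x)"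
    by (rule DERIV_divide[OF du1 du u_neq])
  moreover have "((\<lambda>x. v1 x / v x) has_real_derivative (v2 x * v x - v1 x * v1 x) / (v x * v x)) (at x)"
    by (rule DERIV_divide[OF dv1 dv v_neq])
  moreover have "((\<lambda>x. - (v x * v1 x / (u x)\<^sup>2)) has_real_derivative
      - (((v1 x * v1 x + v x * v2 x) * (u x)\<^sup>2 - v x * v1 x * (2 * u x * u1 x)) / ((u x)\<^sup>2 * (u x)\<^sup>2))) (at x)"
    by (rule derivative_eq_intros dv dv1 du refl | simp add: algebra_simps)+
  ultimately have "\<forall>k i j. (rad k i j has_real_derivative rad' k i j x) (at x)"
    unfolding forall_3 rad_def[abs_def] rad'_def by simp
  then show ?thesis by blast
qed

lemma lat_deriv: "cos y \<noteq> 0 \<Longrightarrow> (lat k i j has_real_derivative lat' k i j y) (at y)"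
proof -
  assume "cos y \<noteq> 0"
  then have "((\<lambda>y. - tan y) has_real_derivative - (1 / (cos y)\<^sup>2)) (at y)"
    by (auto intro!: derivative_eq_intros simp: divide_inverse)
  moreover have "((\<lambda>y. (cos y)\<^sup>2) has_real_derivative - (2 * cos y * sin y)) (at y)"
    by (auto intro!: derivative_eq_intros)
  moreover have "((\<lambda>y. sin y * cos y) has_real_derivative (cos y)\<^sup>2 - (sin y)\<^sup>2) (at y)"
    by (auto intro!: derivative_eq_intros simp: power2_eq_square)
  ultimately have "\<forall>k i j. (lat k i j has_real_derivative lat' k i j y) (at y)"
    unfolding forall_3 lat_def[abs_def] lat'_def by simp
  then show ?thesis by blast
qed

lemma chart_cos: "p \<in> chart_domain \<Longrightarrow> cos (p$2) \<noteq> 0"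
  using cos_gt_zero_pi[of "p$2"] by (auto simp: chart_domain_def)

lemma inv_metric_eq:
  assumes "p \<in> chart_domain"
  shows "inv_metric metric p = diag3 (1 / (u (p$1))\<^sup>2) (1 / (v (p$1))\<^sup>2) (1 / ((v (p$1))\<^sup>2 * (cos (p$2))\<^sup>2))"
  unfolding inv_metric_def metric_def using chart_cos[OF assms] by (subst matrix_inv_diag3) auto

lemma pderiv_metric:
  "pderiv_dir k (\<lambda>q. metric q $ 1 $ 1) p = (if k = 1 then 2 * u (p$1) * u1 (p$1) else 0)"
  "pderiv_dir k (\<lambda>q. metric q $ 2 $ 2) p = (if k = 1 then 2 * v (p$1) * v1 (p$1) else 0)"
  "pderiv_dir k (\<lambda>q. metric q $ 3 $ 3) p =
     (if k = 1 then 2 * v (p$1) * v1 (p$1) * (cos (p$2))\<^sup>2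
      else if k = 2 then - (v (p$1))\<^sup>2 * (2 * cos (p$2) * sin (p$2)) else 0)"
  "i \<noteq> j \<Longrightarrow> pderiv_dir k (\<lambda>q. metric q $ i $ j) p = 0"
proof -
  have u: "((\<lambda>x. (u x)\<^sup>2) has_real_derivative 2 * u (p$1) * u1 (p$1)) (at (p$1))"
    and v: "((\<lambda>x. (v x)\<^sup>2) has_real_derivative 2 * v (p$1) * v1 (p$1)) (at (p$1))"
    and c: "((\<lambda>y. (cos y)\<^sup>2) has_real_derivative - (2 * cos (p$2) * sin (p$2))) (at (p$2))"
    and one: "((\<lambda>_. 1) has_real_derivative 0) (at (p$2))"
    by (auto intro!: derivative_eq_intros du dv)
  show "pderiv_dir k (\<lambda>q. metric q $ 1 $ 1) p = (if k = 1 then 2 * u (p$1) * u1 (p$1) else 0)"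
    using pderiv_dir_prod[OF u one, of k] by (simp add: metric_def)
  show "pderiv_dir k (\<lambda>q. metric q $ 2 $ 2) p = (if k = 1 then 2 * v (p$1) * v1 (p$1) else 0)"
    using pderiv_dir_prod[OF v one, of k] by (simp add: metric_def)
  show "pderiv_dir k (\<lambda>q. metric q $ 3 $ 3) p =
     (if k = 1 then 2 * v (p$1) * v1 (p$1) * (cos (p$2))\<^sup>2
      else if k = 2 then - (v (p$1))\<^sup>2 * (2 * cos (p$2) * sin (p$2)) else 0)"
    using pderiv_dir_prod[OF v c, of k] by (simp add: metric_def)
  show "i \<noteq> j \<Longrightarrow> pderiv_dir k (\<lambda>q. metric q $ i $ j) p = 0"
    by (simp add: metric_def pderiv_dir_def)
qed

lemma christoffel_eq:
  assumes p: "p \<in> chart_domain"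
  shows "christoffel metric k i j p = rad k i j (p$1) * lat k i j (p$2)"
proof -
  have "\<forall>k i j. christoffel metric k i j p = rad k i j (p$1) * lat k i j (p$2)"
    unfolding christoffel_def inv_metric_eq[OF p] forall_3 sum_3
    using chart_cos[OF p]
    by (simp add: pderiv_metric rad_def lat_def tan_def field_simps power2_eq_square)
  then show ?thesis by blast
qed

lemma pderiv_christoffel:
  assumes p: "p \<in> chart_domain"
  shows "pderiv_dir m (christoffel metric k i j) p =
    (if m = 1 then rad' k i j (p$1) * lat k i j (p$2)
     else if m = 2 then rad k i j (p$1) * lat' k i j (p$2) else 0)"
proof -
  \<comment> \<open>The formula for the symbols holds near \<open>p\<close> only, since the metric degenerates at the poles.\<close>
  let ?line = "\<lambda>s. p + s *\<^sub>R axis m (1::real)"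
  have "open chart_domain"
    unfolding chart_domain_def Collect_conj_eq
    by (intro open_Int open_Collect_less continuous_intros)
  moreover have "isCont ?line 0" by (intro continuous_intros)
  ultimately have "\<forall>\<^sub>F s in nhds 0. ?line s \<in> chart_domain"
    using p by (simp add: isCont_def eventually_nhds_conv_at topological_tendstoD)
  then have "pderiv_dir m (christoffel metric k i j) p
      = pderiv_dir m (\<lambda>q. rad k i j (q$1) * lat k i j (q$2)) p"
    unfolding pderiv_dir_def
    by (intro deriv_cong_ev refl) (auto elim!: eventually_mono simp: christoffel_eq)
  then show ?thesis
    using pderiv_dir_prod[OF rad_deriv lat_deriv[OF chart_cos[OF p]]] by simp
qed

text \<open>The first and second derivatives of \<open>v\<close> by arclength: $v'/u$ and $u^{-1} (v'/u)'$.\<close>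
definition "v_s x = v1 x / u x"
definition "v_ss x = (v2 x * u x - v1 x * u1 x) / (u x)^3"

lemma ricci_eq:
  assumes p: "p \<in> chart_domain"
  shows "ricci metric p = diag3 (- 2 * (u (p$1))\<^sup>2 * v_ss (p$1) / v (p$1))
     (1 - (v_s (p$1))\<^sup>2 - v (p$1) * v_ss (p$1))
     ((1 - (v_s (p$1))\<^sup>2 - v (p$1) * v_ss (p$1)) * (cos (p$2))\<^sup>2)"
proof -
  have tan2: "tan (p$2) * tan (p$2) = 1 / (cos (p$2))\<^sup>2 - 1"
    using chart_cos[OF p] sin_cos_squared_add[of "p$2"] by (simp add: tan_def field_simps power2_eq_square)
  have cos_tan: "cos (p$2) * tan (p$2) = sin (p$2)"
    using chart_cos[OF p] by (simp add: tan_def)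
  note expand = ricci_def riemann_def sum_3 pderiv_christoffel[OF p] christoffel_eq[OF p]
    rad_def lat_def rad'_def lat'_def
  have "ricci metric p $ 1 $ 1 = - 2 * (u (p$1))\<^sup>2 * v_ss (p$1) / v (p$1)"
    by (simp add: expand) (simp add: v_ss_def divide_simps power2_eq_square power3_eq_cube)
  moreover have "ricci metric p $ 2 $ 2 = 1 - (v_s (p$1))\<^sup>2 - v (p$1) * v_ss (p$1)"
    by (simp add: expand tan2)
       (simp add: v_s_def v_ss_def divide_simps power2_eq_square power3_eq_cube power4_eq_xxxx,
        simp add: algebra_simps)
  moreover have "ricci metric p $ 3 $ 3 = (1 - (v_s (p$1))\<^sup>2 - v (p$1) * v_ss (p$1)) * (cos (p$2))\<^sup>2"
    by (simp add: expand)
       (simp add: v_s_def v_ss_def divide_simps power2_eq_square power3_eq_cube power4_eq_xxxx,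
        simp add: algebra_simps cos_tan)
  moreover have "ricci metric p $ i $ j = 0" if "i \<noteq> j" for i j
  proof -
    have "\<forall>i j. i \<noteq> j \<longrightarrow> ricci metric p $ i $ j = 0"
      unfolding forall_3 by (simp add: expand)
    with that show ?thesis by blast
  qed
  ultimately show ?thesis by (simp add: vec_eq_iff forall_3)
qed

lemma P_tensor_eq:
  assumes p: "p \<in> chart_domain"
  shows "P_tensor metric p = diag3 (- (1 - (v_s (p$1))\<^sup>2) / ((u (p$1))\<^sup>2 * (v (p$1))\<^sup>2))
     (v_ss (p$1) / v (p$1) ^ 3) (v_ss (p$1) / (v (p$1) ^ 3 * (cos (p$2))\<^sup>2))"
proof -
  have scal: "scalar_curvature metric p
      = 2 * (1 - (v_s (p$1))\<^sup>2) / (v (p$1))\<^sup>2 - 4 * v_ss (p$1) / v (p$1)"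
    unfolding scalar_curvature_def sum_3 ricci_eq[OF p] inv_metric_eq[OF p]
    using chart_cos[OF p] by (simp add: divide_simps power2_eq_square)
  show ?thesis
    unfolding vec_eq_iff forall_3 P_tensor_def sum_3 ricci_eq[OF p] inv_metric_eq[OF p] scal
    using chart_cos[OF p]
    by simp (simp add: divide_simps power2_eq_square power3_eq_cube power4_eq_xxxx)
qed

text \<open>$P$ is singular where $v_s^2 = 1$ or $v_{ss} = 0$; the adjugate covers that case as well.\<close>
lemma cross_curvature_eq:
  assumes p: "p \<in> chart_domain"
  shows "cross_curvature metric p = diag3 ((u (p$1))\<^sup>2 * (v_ss (p$1) / v (p$1))\<^sup>2)
     (- (1 - (v_s (p$1))\<^sup>2) * v_ss (p$1) / v (p$1))
     (- (1 - (v_s (p$1))\<^sup>2) * v_ss (p$1) / v (p$1) * (cos (p$2))\<^sup>2)"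
proof -
  have adj: "adjugate3 (diag3 a b c) = (a * b * c) *\<^sub>R matrix_inv (diag3 a b c)"
    if "invertible (diag3 a b c)" for a b c :: real
    using that by (auto simp: invertible_det_nz adjugate3_diag3 matrix_inv_diag3 vec_eq_iff forall_3)
  have "cross_curvature metric p = (1 / det (inv_metric metric p)) *\<^sub>R adjugate3 (P_tensor metric p)"
    unfolding cross_curvature_def using P_tensor_eq[OF p] by (auto simp: adj)
  also have "\<dots> = diag3 ((u (p$1))\<^sup>2 * (v_ss (p$1) / v (p$1))\<^sup>2)
     (- (1 - (v_s (p$1))\<^sup>2) * v_ss (p$1) / v (p$1))
     (- (1 - (v_s (p$1))\<^sup>2) * v_ss (p$1) / v (p$1) * (cos (p$2))\<^sup>2)"
    unfolding P_tensor_eq[OF p] inv_metric_eq[OF p] adjugate3_diag3 vec_eq_iff forall_3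
    using chart_cos[OF p]
    by simp (simp add: divide_simps power_eq_if)
  finally show ?thesis .
qed

end

section \<open>Maximum principle and variation bound\<close>

lemma second_derivative_nonpos_at_max:
  fixes f f' :: "real \<Rightarrow> real"
  assumes f: "\<And>x. (f has_real_derivative f' x) (at x)"
    and f': "(f' has_real_derivative d) (at a)"
    and max: "\<And>x. f x \<le> f a"
  shows "f' a = 0" and "d \<le> 0"
proof -
  show crit: "f' a = 0"
    using DERIV_local_max[OF f, of 1 a] max by auto
  show "d \<le> 0"
  proof (rule ccontr)
    assume "\<not> d \<le> 0"
    then obtain e where e: "e > 0" "\<And>h. 0 < h \<Longrightarrow> h < e \<Longrightarrow> f' (a + h) > 0"
      using DERIV_pos_inc_right[OF f'] crit by auto
    obtain z where z: "a < z" "z < a + e/2" "f (a + e/2) - f a = (a + e/2 - a) * f' z"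
      using MVT2[of a "a + e/2" f f'] f e(1) by auto
    have "f' z > 0" using e(2)[of "z - a"] z by auto
    with z(3) e(1) have "f (a + e/2) > f a"
      by (smt (verit) mult_pos_pos half_gt_zero)
    with max[of "a + e/2"] show False by simp
  qed
qed

text \<open>Maximum principle for functions that are periodic in space, stated by requiring that every
  spatial point may be replaced by one in \<open>{0..c}\<close>. The evolution equation enters only through
  the sign of \<open>Ut\<close> at points that satisfy the first and second order conditions for a spatial
  maximum.\<close>
lemma parabolic_maximum_principle:
  fixes U Ux Uxx Ut :: "real \<Rightarrow> real \<Rightarrow> real"
  assumes cont: "continuous_on (UNIV \<times> {0..}) (\<lambda>(x, t). U x t)"
    and per: "\<And>x. \<exists>y\<in>{0..c}. \<forall>t\<ge>0. U x t = U y t"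
    and Ux: "\<And>x t. t \<ge> 0 \<Longrightarrow> ((\<lambda>x. U x t) has_real_derivative Ux x t) (at x)"
    and Uxx: "\<And>x t. t \<ge> 0 \<Longrightarrow> ((\<lambda>x. Ux x t) has_real_derivative Uxx x t) (at x)"
    and Ut: "\<And>x t. t \<ge> 0 \<Longrightarrow> (U x has_real_derivative Ut x t) (at t within {0..})"
    and crit: "\<And>x t. t \<ge> 0 \<Longrightarrow> Ux x t = 0 \<Longrightarrow> Uxx x t \<le> 0 \<Longrightarrow> Ut x t \<le> 0"
    and s: "s \<ge> 0" and init: "\<And>x. U x s \<le> M" and st: "s \<le> t"
  shows "U x t \<le> M"
proof (rule ccontr)
  assume neg: "\<not> U x t \<le> M"
  then have "s < t" using init[of x] st by (cases "s = t") auto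
  \<comment> \<open>Subtracting \<open>e * (\<tau> - s)\<close> makes the time derivative strictly negative at a maximum, while
    \<open>e\<close> is small enough for the bound to remain violated at \<open>(x, t)\<close>.\<close>
  define e where "e = (U x t - M) / (2 * (t - s))"
  have e: "e > 0" using neg \<open>s < t\<close> by (simp add: e_def)
  have "e * (t - s) = (U x t - M) / 2" using \<open>s < t\<close> by (simp add: e_def divide_simps)
  then have above: "U x t - e * (t - s) > M" using neg by simp
  define \<phi> where "\<phi> = (\<lambda>(y, \<tau>). U y \<tau> - e * (\<tau> - s))"
  let ?K = "{0..c} \<times> {s..t}"
  have "continuous_on ?K (\<lambda>z. (\<lambda>(x, t). U x t) z - e * (snd z - s))"
    by (intro continuous_intros continuous_on_subset[OF cont]) (use s in auto)
  then have "continuous_on ?K \<phi>" by (simp add: \<phi>_def case_prod_unfold)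
  moreover have "?K \<noteq> {}" using per[of x] st by auto
  moreover have "compact ?K" by (intro compact_Times compact_Icc)
  ultimately obtain z0 where "z0 \<in> ?K" and z0: "\<And>z. z \<in> ?K \<Longrightarrow> \<phi> z \<le> \<phi> z0"
    using continuous_attains_sup[of ?K \<phi>] by blast
  then obtain y0 \<tau>0 where yt: "z0 = (y0, \<tau>0)" "y0 \<in> {0..c}" "\<tau>0 \<in> {s..t}" by blast
  have glob: "U y \<tau> - e * (\<tau> - s) \<le> U y0 \<tau>0 - e * (\<tau>0 - s)" if \<tau>: "\<tau> \<in> {s..t}" for y \<tau>
  proof -
    obtain y' where "y' \<in> {0..c}" "\<forall>t\<ge>0. U y t = U y' t" using per[of y] by blast
    then show ?thesis using z0[of "(y', \<tau>)"] \<tau> s by (auto simp: \<phi>_def yt)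
  qed
  have t0: "s < \<tau>0"
    using glob[of t x] above init[of y0] yt st by (cases "\<tau>0 = s") auto
  then have t0': "0 \<le> \<tau>0" using s by simp
  have max: "U y \<tau>0 \<le> U y0 \<tau>0" for y using glob[OF yt(3), of y] by simp
  have "Ut y0 \<tau>0 \<le> 0"
    using crit[OF t0'] second_derivative_nonpos_at_max[OF Ux[OF t0'] Uxx[OF t0'] max] by blast
  moreover have "((\<lambda>\<tau>. U y0 \<tau> - e * (\<tau> - s)) has_real_derivative Ut y0 \<tau>0 - e) (at \<tau>0 within {0..})"
    using Ut[OF t0', of y0] by (auto intro!: derivative_eq_intros)
  ultimately obtain d where d: "d > 0"
    "\<And>h. 0 < h \<Longrightarrow> \<tau>0 - h \<in> {0..} \<Longrightarrow> h < d \<Longrightarrow>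
      U y0 \<tau>0 - e * (\<tau>0 - s) < U y0 (\<tau>0 - h) - e * (\<tau>0 - h - s)"
    using has_real_derivative_neg_dec_left[of "\<lambda>\<tau>. U y0 \<tau> - e * (\<tau> - s)" _ \<tau>0 "{0..}"] e by force
  define h where "h = min (d/2) (\<tau>0 - s)"
  have "0 < h" "h < d" "h \<le> \<tau>0 - s" using d(1) t0 by (auto simp: h_def)
  then show False
    using d(2)[of h] glob[of "\<tau>0 - h" y0] yt(3) s by auto
qed

lemma variation_le_integral:
  fixes \<phi> \<phi>' \<psi> :: "real \<Rightarrow> real"
  assumes deriv: "\<And>x. (\<phi> has_real_derivative \<phi>' x) (at x)"
    and cont: "continuous_on {a..b} \<psi>"
    and bound: "\<And>x. \<bar>\<phi>' x\<bar> \<le> \<psi> x"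
    and xy: "x \<in> {a..b}" "y \<in> {a..b}"
  shows "\<bar>\<phi> x - \<phi> y\<bar> \<le> integral {a..b} \<psi>"
  using xy
proof (induction x y rule: linorder_wlog)
  case (le x y)
  have "(\<phi>' has_integral \<phi> y - \<phi> x) {x..y}"
    using le(1) deriv
    by (intro fundamental_theorem_of_calculus)
       (auto simp: has_real_derivative_iff_has_vector_derivative[symmetric] intro: DERIV_subset)
  moreover have int: "\<psi> integrable_on {x..y}" "\<psi> integrable_on {a..b}"
    using le by (auto intro!: integrable_continuous_interval continuous_on_subset[OF cont])
  ultimately have "\<bar>\<phi> y - \<phi> x\<bar> \<le> integral {x..y} \<psi>"
    using integral_norm_bound_integral[of \<phi>' "{x..y}" \<psi>] bound
    by (auto simp: has_integral_iff)
  also have "\<dots> \<le> integral {a..b} \<psi>"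
    using le by (intro integral_subset_le int) (auto intro: order_trans[OF abs_ge_zero bound])
  finally show ?case by (simp add: abs_minus_commute)
next
  case (sym x y)
  then show ?case by (simp add: abs_minus_commute)
qed

section \<open>Oscillation of the warping function\<close>

context warped_product
begin

lemma v_s_deriv: "(v_s has_real_derivative u x * v_ss x) (at x)"
proof -
  have "((\<lambda>x. v1 x / u x) has_real_derivative (v2 x * u x - v1 x * u1 x) / (u x * u x)) (at x)"
    by (rule DERIV_divide[OF dv1 du u_neq])
  moreover have "(v2 x * u x - v1 x * u1 x) / (u x * u x) = u x * v_ss x"
    by (simp add: v_ss_def power3_eq_cube)
  ultimately show ?thesis by (simp add: v_s_def[abs_def])
qed

lemma continuous_profile:
  assumes "continuous_on A v2"
  shows "continuous_on A u" "continuous_on A (\<lambda>x. u x * (v_ss x / v x)\<^sup>2)"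
proof -
  have c: "continuous_on A u" "continuous_on A u1" "continuous_on A v" "continuous_on A v1"
    using du du1 dv dv1 by (auto intro!: continuous_at_imp_continuous_on DERIV_isCont)
  then show "continuous_on A u" by simp
  show "continuous_on A (\<lambda>x. u x * (v_ss x / v x)\<^sup>2)"
    unfolding v_ss_def by (intro continuous_intros c assms) auto
qed

text \<open>A small energy $\int (v_{ss}/v)^2 u\,dx$ on a closed curve of bounded length forces a
  bounded warping function to be almost constant.\<close>
lemma oscillation_le:
  assumes "c > 0" and closed: "v 0 = v c" and cont: "continuous_on {0..c} v2"
    and K: "\<And>x. v x \<le> K"
    and L: "integral {0..c} u \<le> L"
    and "\<eta> > 0" and energy: "integral {0..c} (\<lambda>x. u x * (v_ss x / v x)\<^sup>2) \<le> \<eta>\<^sup>2"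
    and xy: "x \<in> {0..c}" "y \<in> {0..c}"
    and per: "\<And>x. \<exists>y\<in>{0..c}. v_s x = v_s y"
  shows "\<bar>v x - v y\<bar> \<le> K * \<eta> * (L + 1) / 2 * L"
proof -
  define E where "E = (\<lambda>x. u x * (v_ss x / v x)\<^sup>2)"
  define \<psi> where "\<psi> = (\<lambda>x. K * (\<eta>/2 * u x + 1/(2*\<eta>) * E x))"
  have K0: "K > 0" using K[of 0] v_pos[of 0] by linarith
  have cont_u: "continuous_on {0..c} u" and cont_E: "continuous_on {0..c} E"
    using continuous_profile[OF cont] by (auto simp: E_def)
  have int: "u integrable_on {0..c}" "E integrable_on {0..c}"
    using cont_u cont_E by (auto intro: integrable_continuous_interval)
  have "\<bar>u z * v_ss z\<bar> \<le> \<psi> z" for z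
  proof -
    define r where "r = \<bar>v_ss z / v z\<bar>"
    \<comment> \<open>Young's inequality takes the place of the Cauchy--Schwarz inequality for integrals.\<close>
    have "0 \<le> (r - \<eta>)\<^sup>2" by simp
    then have "2 * \<eta> * r \<le> \<eta>\<^sup>2 + r\<^sup>2" by (simp add: power2_eq_square algebra_simps)
    then have young: "r \<le> \<eta>/2 + 1/(2*\<eta>) * r\<^sup>2"
      using \<open>\<eta> > 0\<close> by (simp add: field_simps power2_eq_square)
    have "r \<ge> 0" by (simp add: r_def)
    have "\<bar>u z * v_ss z\<bar> = u z * (v z * r)"
      using u_pos[of z] v_pos[of z] by (simp add: r_def abs_mult abs_divide)
    also have "\<dots> \<le> u z * (K * (\<eta>/2 + 1/(2*\<eta>) * r\<^sup>2))"
      using u_pos[of z] v_pos[of z] K[of z] K0 young \<open>r \<ge> 0\<close>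
      by (intro mult_left_mono mult_mono) auto
    also have "\<dots> = \<psi> z"
      unfolding \<psi>_def E_def r_def power2_abs by (simp add: algebra_simps)
    finally show ?thesis .
  qed
  moreover have "continuous_on {0..c} \<psi>"
    unfolding \<psi>_def by (intro continuous_intros cont_u cont_E)
  ultimately have osc_s: "\<bar>v_s a - v_s b\<bar> \<le> integral {0..c} \<psi>" if "a \<in> {0..c}" "b \<in> {0..c}" for a b
    using variation_le_integral[of v_s "\<lambda>x. u x * v_ss x" 0 c \<psi>] v_s_deriv that by blast
  have "integral {0..c} \<psi> = K * (\<eta>/2 * integral {0..c} u + 1/(2*\<eta>) * integral {0..c} E)"
    unfolding \<psi>_def integral_mult_right
    using int by (subst integral_add) (auto intro: integrable_on_mult_right integrable_on_divide)
  also have "\<dots> \<le> K * (\<eta>/2 * L + 1/(2*\<eta>) * \<eta>\<^sup>2)"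
    using L energy K0 \<open>\<eta> > 0\<close> unfolding E_def by (intro mult_left_mono add_mono) auto
  also have "\<dots> = K * \<eta> * (L + 1) / 2"
    using \<open>\<eta> > 0\<close> by (simp add: field_simps power2_eq_square)
  finally have psi: "integral {0..c} \<psi> \<le> K * \<eta> * (L + 1) / 2" (is "_ \<le> ?B") .
  \<comment> \<open>Rolle's theorem: \<open>v\<close> takes equal values at the endpoints, so \<open>v_s\<close> has a zero.\<close>
  obtain z where z: "0 < z" "z < c" "v1 z = 0"
    using MVT2[of 0 c v v1] dv closed \<open>c > 0\<close> by auto
  have "\<bar>v1 a\<bar> \<le> ?B * u a" for a
  proof -
    obtain b where b: "b \<in> {0..c}" "v_s a = v_s b" using per by blast
    have "\<bar>v_s b - v_s z\<bar> \<le> ?B"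
      using osc_s[OF b(1), of z] z psi by auto
    then have "\<bar>v_s a\<bar> \<le> ?B"
      using z(3) b(2) by (simp add: v_s_def)
    then show ?thesis using u_pos[of a] by (simp add: v_s_def abs_divide field_simps)
  qed
  then have "\<bar>v x - v y\<bar> \<le> integral {0..c} (\<lambda>a. ?B * u a)"
    by (intro variation_le_integral[OF dv _ _ xy] continuous_on_mult_left cont_u)
  also have "\<dots> \<le> ?B * L"
  proof -
    have "0 \<le> integral {0..c} \<psi>" using osc_s[of 0 0] \<open>c > 0\<close> by auto
    then show ?thesis using L psi by (auto intro!: mult_left_mono)
  qed
  finally show ?thesis .
qed

end

section \<open>The flow of the profile functions\<close>

text \<open>Positive solutions \<open>f\<close>, \<open>g\<close> of the evolution equations, as functions on the real line that are
  \<open>c\<close>-periodic in space. The other parameters are the partial derivatives indicated by their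
  names.\<close>
locale cross_curvature_profile =
  fixes c :: real and f fx fxx ft g gx gxx gt :: "real \<Rightarrow> real \<Rightarrow> real"
  assumes c_pos: "c > 0"
    and f_pos: "\<And>x t. t \<ge> 0 \<Longrightarrow> f x t > 0" and g_pos: "\<And>x t. t \<ge> 0 \<Longrightarrow> g x t > 0"
    and f_x: "\<And>x t. t \<ge> 0 \<Longrightarrow> ((\<lambda>x. f x t) has_real_derivative fx x t) (at x)"
    and f_xx: "\<And>x t. t \<ge> 0 \<Longrightarrow> ((\<lambda>x. fx x t) has_real_derivative fxx x t) (at x)"
    and g_x: "\<And>x t. t \<ge> 0 \<Longrightarrow> ((\<lambda>x. g x t) has_real_derivative gx x t) (at x)"
    and g_xx: "\<And>x t. t \<ge> 0 \<Longrightarrow> ((\<lambda>x. gx x t) has_real_derivative gxx x t) (at x)"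
    and f_t: "\<And>x t. t \<ge> 0 \<Longrightarrow> (f x has_real_derivative ft x t) (at t within {0..})"
    and g_t: "\<And>x t. t \<ge> 0 \<Longrightarrow> (g x has_real_derivative gt x t) (at t within {0..})"
    and cont_g: "continuous_on (UNIV \<times> {0..}) (\<lambda>(x, t). g x t)"
    and cont_gxx: "continuous_on (UNIV \<times> {0..}) (\<lambda>(x, t). gxx x t)"
    and cont_ft: "continuous_on (UNIV \<times> {0..}) (\<lambda>(x, t). ft x t)"
    and per_f: "\<And>x t. t \<ge> 0 \<Longrightarrow> f (x + c) t = f x t"
    and per_g: "\<And>x t. t \<ge> 0 \<Longrightarrow> g (x + c) t = g x t"
    and ft_eq: "\<And>x t. t \<ge> 0 \<Longrightarrow> ft x t =
          - f x t * (warped_product.v_ss (\<lambda>x. f x t) (\<lambda>x. fx x t) (\<lambda>x. gx x t) (\<lambda>x. gxx x t) x / g x t)\<^sup>2"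
    and gt_eq: "\<And>x t. t \<ge> 0 \<Longrightarrow> gt x t =
          (1 - (warped_product.v_s (\<lambda>x. f x t) (\<lambda>x. gx x t) x)\<^sup>2) *
          warped_product.v_ss (\<lambda>x. f x t) (\<lambda>x. fx x t) (\<lambda>x. gx x t) (\<lambda>x. gxx x t) x / (g x t)\<^sup>2"
begin

lemma slice: "t \<ge> 0 \<Longrightarrow> warped_product (\<lambda>x. f x t) (\<lambda>x. fx x t) (\<lambda>x. fxx x t)
    (\<lambda>x. g x t) (\<lambda>x. gx x t) (\<lambda>x. gxx x t)"
  by unfold_locales (simp_all add: f_pos g_pos f_x f_xx g_x g_xx)

abbreviation "gs x t \<equiv> warped_product.v_s (\<lambda>x. f x t) (\<lambda>x. gx x t) x"
abbreviation "gss x t \<equiv>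
  warped_product.v_ss (\<lambda>x. f x t) (\<lambda>x. fx x t) (\<lambda>x. gx x t) (\<lambda>x. gxx x t) x"

lemma fundamental_domain: "\<exists>y\<in>{0..c}. \<exists>k::int. x = y + k * c"
proof -
  have "x = c * frac (x/c) + \<lfloor>x/c\<rfloor> * c"
    using c_pos by (simp add: frac_def algebra_simps)
  moreover have "c * frac (x/c) \<in> {0..c}"
    using c_pos frac_lt_1[of "x/c"] by (auto simp: less_imp_le)
  ultimately show ?thesis by blast
qed

lemma periodic_int:
  fixes h :: "real \<Rightarrow> real"
  assumes "\<And>x. h (x + c) = h x"
  shows "h (x + of_int k * c) = h x"
proof (induction k rule: int_induct[where k = 0])
  case base
  show ?case by simp
next
  case (step1 i)
  then show ?case using assms[of "x + of_int i * c"] by (simp add: algebra_simps)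
next
  case (step2 i)
  then show ?case using assms[of "x + of_int (i - 1) * c"] by (simp add: algebra_simps)
qed

lemma per_gx:
  assumes "t \<ge> 0" shows "gx (x + c) t = gx x t"
proof -
  have "((\<lambda>x. g (x + c) t) has_real_derivative gx (x + c) t) (at x)"
    using g_x[OF assms, of "x + c"] by (subst (asm) DERIV_shift)
  then have "((\<lambda>x. g x t) has_real_derivative gx (x + c) t) (at x)"
    using per_g[OF assms] by simp
  then show ?thesis using g_x[OF assms] DERIV_unique by blast
qed

lemma g_period: "\<exists>y\<in>{0..c}. \<forall>t\<ge>0. g x t = g y t"
  using fundamental_domain[of x] periodic_int[of "\<lambda>x. g x t" for t] per_g by metis

lemma gs_period:
  assumes "t \<ge> 0" shows "\<exists>y\<in>{0..c}. gs x t = gs y t"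
proof -
  obtain y k where y: "y \<in> {0..c}" "x = y + of_int k * c" using fundamental_domain[of x] by blast
  have "gs x t = gs y t"
    using y periodic_int[of "\<lambda>x. f x t"] per_f[OF assms] periodic_int[of "\<lambda>x. gx x t"] per_gx[OF assms]
    by (simp add: warped_product.v_s_def[OF slice[OF assms]])
  with y show ?thesis by blast
qed

text \<open>Where $g_x = 0$, the factor $1 - g_s^2$ is \<open>1\<close>, so the sign of $g_t$ is that of $g_{xx}$ whatever
  the size of $g_s$ elsewhere.\<close>
lemma gt_at_critical_point:
  assumes "t \<ge> 0" "gx x t = 0"
  shows "gt x t = gxx x t / (f x t * g x t)\<^sup>2"
  using assms f_pos[OF assms(1), of x] g_pos[OF assms(1), of x]
  by (simp add: gt_eq warped_product.v_s_def[OF slice] warped_product.v_ss_def[OF slice]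
      divide_simps power2_eq_square power3_eq_cube)

lemma upper_bound_preserved:
  assumes "s \<ge> 0" "\<And>x. g x s \<le> M" "s \<le> t"
  shows "g x t \<le> M"
proof (rule parabolic_maximum_principle[OF cont_g g_period g_x g_xx g_t _ assms])
  fix x t :: real assume "t \<ge> 0" "gx x t = 0" "gxx x t \<le> 0"
  then show "gt x t \<le> 0" by (simp add: gt_at_critical_point divide_nonpos_nonneg)
qed auto

lemma lower_bound_preserved:
  assumes "s \<ge> 0" "\<And>x. m \<le> g x s" "s \<le> t"
  shows "m \<le> g x t"
proof -
  have "- g x t \<le> - m"
  proof (rule parabolic_maximum_principle[where c = c and s = s
        and U = "\<lambda>x t. - g x t" and Ux = "\<lambda>x t. - gx x t"
        and Uxx = "\<lambda>x t. - gxx x t" and Ut = "\<lambda>x t. - gt x t"])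
    show "continuous_on (UNIV \<times> {0..}) (\<lambda>(x, t). - g x t)"
      using continuous_on_minus[OF cont_g] by (simp add: case_prod_unfold)
    show "\<exists>y\<in>{0..c}. \<forall>t\<ge>0. - g x t = - g y t" for x using g_period by simp
    show "((\<lambda>x. - g x t) has_real_derivative - gx x t) (at x)" if "t \<ge> 0" for x t
      by (rule DERIV_minus[OF g_x[OF that]])
    show "((\<lambda>x. - gx x t) has_real_derivative - gxx x t) (at x)" if "t \<ge> 0" for x t
      by (rule DERIV_minus[OF g_xx[OF that]])
    show "((\<lambda>t. - g x t) has_real_derivative - gt x t) (at t within {0..})" if "t \<ge> 0" for x t
      by (rule DERIV_minus[OF g_t[OF that]])
    show "- gt x t \<le> 0" if "t \<ge> 0" "- gx x t = 0" "- gxx x t \<le> 0" for x t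
      using that by (simp add: gt_at_critical_point)
  qed (use assms in auto)
  then show ?thesis by simp
qed

text \<open>The length of the circle, and the integral of $(g_{ss}/g)^2$ by arclength.\<close>
definition len :: "real \<Rightarrow> real" where "len t = integral {0..c} (\<lambda>x. f x t)"
definition energy :: "real \<Rightarrow> real" where
  "energy t = integral {0..c} (\<lambda>x. f x t * (gss x t / g x t)\<^sup>2)"

lemma continuous_gxx: "t \<ge> 0 \<Longrightarrow> continuous_on A (\<lambda>x. gxx x t)"
  using continuous_on_compose2[OF cont_gxx continuous_on_Pair[OF continuous_on_id continuous_on_const[of A t]]]
  by auto

lemma len_deriv:
  assumes "t \<ge> 0" shows "(len has_real_derivative - energy t) (at t within {0..})"
proof -
  have "((\<lambda>t. integral (cbox 0 c) (\<lambda>x. f x t)) has_field_derivative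
      integral (cbox 0 c) (\<lambda>x. ft x t)) (at t within {0..})"
  proof (rule leibniz_rule_field_derivative)
    show "(f x has_real_derivative ft x t) (at t within {0..})" if "t \<in> {0..}" for t x
      using f_t that by simp
    show "(\<lambda>x. f x t) integrable_on cbox 0 c" if "t \<in> {0..}" for t
      using that
      by (auto intro!: integrable_continuous_interval
          warped_product.continuous_profile(1)[OF slice continuous_gxx])
    have "continuous_on ({0..} \<times> cbox 0 c) (\<lambda>z. (\<lambda>(x, t). ft x t) (snd z, fst z))"
      by (rule continuous_on_compose2[OF cont_ft], intro continuous_intros) auto
    then show "continuous_on ({0..} \<times> cbox 0 c) (\<lambda>(t, x). ft x t)"
      by (simp add: case_prod_unfold)
  qed (use assms in auto)
  moreover have "integral (cbox 0 c) (\<lambda>x. ft x t) = - energy t"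
    unfolding energy_def using assms by (simp add: ft_eq)
  ultimately show ?thesis by (simp add: len_def[abs_def])
qed

lemma len_nonneg: "t \<ge> 0 \<Longrightarrow> len t \<ge> 0" and energy_nonneg: "t \<ge> 0 \<Longrightarrow> energy t \<ge> 0"
  unfolding len_def energy_def
  by (auto intro!: integral_nonneg integrable_continuous_interval
      warped_product.continuous_profile[OF slice continuous_gxx] simp: less_imp_le[OF f_pos])

lemma len_decrease:
  assumes "t \<ge> 0" and \<delta>: "\<And>s. s \<ge> 0 \<Longrightarrow> energy s \<ge> \<delta>"
  shows "len t \<le> len 0 - \<delta> * t"
proof (cases "t = 0")
  case False
  with assms have "t > 0" by simp
  have "(len has_derivative (\<lambda>h. - energy x * h)) (at x within {0..t})" if "0 \<le> x" "x \<le> t" for x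
    using len_deriv[OF that(1)] unfolding has_field_derivative_def
    by (rule has_derivative_subset) auto
  from mvt_simple[OF \<open>t > 0\<close> this]
  obtain z where z: "z \<in> {0<..<t}" "len t - len 0 = - energy z * (t - 0)"
    by blast
  have "\<delta> * t \<le> energy z * t"
    using \<delta>[of z] z(1) \<open>t > 0\<close> by (intro mult_right_mono) auto
  moreover have "len t = len 0 - energy z * t" using z(2) by simp
  ultimately show ?thesis by linarith
qed simp

lemma energy_small:
  assumes "\<delta> > 0" shows "\<exists>t\<ge>0. energy t < \<delta>"
proof (rule ccontr)
  assume "\<not> ?thesis"
  then have "len t \<le> len 0 - \<delta> * t" if "t \<ge> 0" for t
    using len_decrease[OF that, of \<delta>] by force
  moreover define t where "t = (len 0 + 1) / \<delta>"
  moreover have "t \<ge> 0" "\<delta> * t = len 0 + 1"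
    using assms len_nonneg[of 0] by (simp_all add: t_def)
  ultimately show False using len_nonneg[of t] by fastforce
qed

lemma g_bounds: "\<exists>m K. 0 < m \<and> (\<forall>x. \<forall>t\<ge>0. m \<le> g x t \<and> g x t \<le> K)"
proof -
  have "continuous_on {0..c} (\<lambda>x. g x 0)"
    by (rule continuous_at_imp_continuous_on) (use g_x[OF order_refl] DERIV_isCont in blast)
  then have "\<exists>a\<in>{0..c}. \<forall>x\<in>{0..c}. g a 0 \<le> g x 0"
    and "\<exists>b\<in>{0..c}. \<forall>x\<in>{0..c}. g x 0 \<le> g b 0"
    using c_pos by (intro continuous_attains_inf continuous_attains_sup; simp)+
  then obtain a b where a: "\<forall>x\<in>{0..c}. g a 0 \<le> g x 0" and b: "\<forall>x\<in>{0..c}. g x 0 \<le> g b 0"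
    by blast
  have init: "g a 0 \<le> g x 0" "g x 0 \<le> g b 0" for x
  proof -
    obtain y where "y \<in> {0..c}" "g x 0 = g y 0" using g_period[of x] by blast
    with a b show "g a 0 \<le> g x 0" "g x 0 \<le> g b 0" by simp_all
  qed
  have "g a 0 \<le> g x t \<and> g x t \<le> g b 0" if "t \<ge> 0" for x t
    using upper_bound_preserved[OF order_refl init(2) that]
      lower_bound_preserved[OF order_refl init(1) that] by blast
  moreover have "g a 0 > 0" by (rule g_pos) simp
  ultimately show ?thesis by blast
qed

lemma oscillation_small:
  assumes "e > 0" shows "\<exists>T\<ge>0. \<forall>x y. \<bar>g x T - g y T\<bar> \<le> e"
proof -
  obtain K where K: "\<And>x t. t \<ge> 0 \<Longrightarrow> g x t \<le> K" using g_bounds by blast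
  have K0: "K > 0" using K[of 0 0] g_pos[of 0 0] by linarith
  define B where "B = K * (len 0 + 1) / 2 * len 0"
  have B: "B \<ge> 0" using K0 len_nonneg[of 0] by (simp add: B_def)
  define \<eta> where "\<eta> = e / (B + 1)"
  have eta: "\<eta> > 0" using assms B by (simp add: \<eta>_def)
  obtain T where T: "T \<ge> 0" "energy T < \<eta>\<^sup>2" using energy_small[of "\<eta>\<^sup>2"] eta by auto
  have lenT: "len T \<le> len 0" using len_decrease[OF T(1), of 0] energy_nonneg by simp
  have *: "\<bar>g x T - g y T\<bar> \<le> e" if xy: "x \<in> {0..c}" "y \<in> {0..c}" for x y
  proof -
    have "\<bar>g x T - g y T\<bar> \<le> K * \<eta> * (len 0 + 1) / 2 * len 0"
    proof (rule warped_product.oscillation_le[OF slice[OF T(1)] c_pos _ continuous_gxx[OF T(1)] K[OF T(1)] _ eta _ xy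
          gs_period[OF T(1)]])
      show "g 0 T = g c T" using per_g[OF T(1), of 0] by simp
      show "integral {0..c} (\<lambda>x. f x T) \<le> len 0" using lenT by (simp add: len_def)
      show "integral {0..c} (\<lambda>x. f x T * (gss x T / g x T)\<^sup>2) \<le> \<eta>\<^sup>2"
        using T(2) by (simp add: energy_def)
    qed
    also have "\<dots> = B * \<eta>" by (simp add: B_def)
    also have "\<dots> \<le> e" using assms B by (simp add: \<eta>_def field_simps)
    finally show ?thesis .
  qed
  have "\<bar>g x T - g y T\<bar> \<le> e" for x y
  proof -
    obtain x' where "x' \<in> {0..c}" "g x T = g x' T" using g_period[of x] T(1) by blast
    moreover obtain y' where "y' \<in> {0..c}" "g y T = g y' T" using g_period[of y] T(1) by blast
    ultimately show ?thesis using * by simp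
  qed
  with T(1) show ?thesis by blast
qed

lemma converges_to_constant:
  "\<exists>\<alpha>>0. \<forall>e>0. \<exists>T\<ge>0. \<forall>t\<ge>T. \<forall>x. \<bar>g x t - \<alpha>\<bar> < e"
proof -
  obtain m K where m: "m > 0" and mK: "\<And>x t. t \<ge> 0 \<Longrightarrow> m \<le> g x t" "\<And>x t. t \<ge> 0 \<Longrightarrow> g x t \<le> K"
    using g_bounds by blast
  \<comment> \<open>\<open>\<alpha>\<close> is the supremum over time of the spatial minimum of \<open>g\<close>.\<close>
  define S where "S = {b. \<exists>T\<ge>0. \<forall>x. b \<le> g x T}"
  define \<alpha> where "\<alpha> = Sup S"
  have upper: "\<alpha> \<le> M" if M: "T \<ge> 0" "\<And>x. g x T \<le> M" for T M
    unfolding \<alpha>_def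
  proof (rule cSup_least)
    show "S \<noteq> {}" using mK(1)[of 0] by (auto simp: S_def)
    fix b assume "b \<in> S"
    then obtain T' where T': "T' \<ge> 0" "\<And>x. b \<le> g x T'" by (auto simp: S_def)
    have "b \<le> g 0 (max T T')" using lower_bound_preserved[OF T'] by simp
    also have "\<dots> \<le> M" using upper_bound_preserved[OF M] by simp
    finally show "b \<le> M" .
  qed
  have "bdd_above S"
  proof (rule bdd_aboveI)
    fix b assume "b \<in> S"
    then obtain T where "T \<ge> 0" "b \<le> g 0 T" by (auto simp: S_def)
    then show "b \<le> K" using mK(2)[of T 0] by linarith
  qed
  then have lower: "b \<le> \<alpha>" if "T \<ge> 0" "\<And>x. b \<le> g x T" for b T
    unfolding \<alpha>_def using that by (intro cSup_upper) (auto simp: S_def)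
  have "\<exists>T\<ge>0. \<forall>t\<ge>T. \<forall>x. \<bar>g x t - \<alpha>\<bar> < e" if "e > 0" for e
  proof -
    obtain T where T: "T \<ge> 0" "\<And>x y. \<bar>g x T - g y T\<bar> \<le> e/3"
      using oscillation_small[of "e/3"] \<open>e > 0\<close> by auto
    have b: "g 0 T - e/3 \<le> g x T" "g x T \<le> g 0 T + e/3" for x using T(2)[of x 0] by linarith+
    have "\<bar>g x t - \<alpha>\<bar> < e" if "t \<ge> T" for t x
      using upper[OF T(1) b(2)] lower[OF T(1) b(1)] upper_bound_preserved[OF T(1) b(2) that, of x]
        lower_bound_preserved[OF T(1) b(1) that, of x] \<open>e > 0\<close> by linarith
    with T(1) show ?thesis by blast
  qed
  moreover have "\<alpha> > 0" using lower[of 0 m] mK(1) m by force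
  ultimately show ?thesis by blast
qed

end

section \<open>Convergence of the flow\<close>

lemma one_sided_derivative_unique:
  fixes h :: "real \<Rightarrow> real"
  assumes "t \<ge> 0" "(h has_real_derivative a) (at t within {0..})"
    and "(h has_real_derivative b) (at t within {0..})"
  shows "a = b"
proof -
  have "at t within {0..} \<noteq> bot"
    using at_le[of "{t<..}" "{0..}" t] assms(1) trivial_limit_at_right_real[of t]
    by (metis atLeast_iff bot_unique greaterThan_iff less_imp_le order_trans subsetI)
  then show ?thesis
    using assms(2,3) vector_derivative_unique_within[of t "{0..}" h a b]
    by (simp add: has_real_derivative_iff_has_vector_derivative)
qed

lemma cis_period: "cis (x + 2 * pi) = cis x"
  by (simp add: cis.ctr complex_eq_iff)

theorem theorem14:
  fixes f g :: "complex \<Rightarrow> real \<Rightarrow> real"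
  assumes "smooth_circle_time f" and "smooth_circle_time g"
    and "\<And>w t. w \<in> sphere 0 1 \<Longrightarrow> t \<ge> 0 \<Longrightarrow> f w t > 0"
    and "\<And>w t. w \<in> sphere 0 1 \<Longrightarrow> t \<ge> 0 \<Longrightarrow> g w t > 0"
    and "cross_curvature_flow_on chart_domain (warped_metric f g)"
    and "\<And>x. \<bar>arclength_deriv f g x 0\<bar> \<le> 1/4"
  shows "\<exists>\<alpha>>0. uniform_limit (sphere 0 1) (\<lambda>t w. g w t) (\<lambda>_. \<alpha>) at_top"
proof -
  obtain F where F: "\<And>x t. t \<ge> 0 \<Longrightarrow> F 0 0 x t = f (cis x) t"
    and F_cont: "\<And>i j. continuous_on (UNIV \<times> {0..}) (\<lambda>(x, t). F i j x t)"
    and F_x: "\<And>i j x t. t \<ge> 0 \<Longrightarrow> ((\<lambda>\<xi>. F i j \<xi> t) has_real_derivative F (Suc i) j x t) (at x)"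
    and F_t: "\<And>i j x t. t \<ge> 0 \<Longrightarrow> (F i j x has_real_derivative F i (Suc j) x t) (at t within {0..})"
    using assms(1) unfolding smooth_circle_time_def by metis
  obtain G where G: "\<And>x t. t \<ge> 0 \<Longrightarrow> G 0 0 x t = g (cis x) t"
    and G_cont: "\<And>i j. continuous_on (UNIV \<times> {0..}) (\<lambda>(x, t). G i j x t)"
    and G_x: "\<And>i j x t. t \<ge> 0 \<Longrightarrow> ((\<lambda>\<xi>. G i j \<xi> t) has_real_derivative G (Suc i) j x t) (at x)"
    and G_t: "\<And>i j x t. t \<ge> 0 \<Longrightarrow> (G i j x has_real_derivative G i (Suc j) x t) (at t within {0..})"
    using assms(2) unfolding smooth_circle_time_def by metis
  have F_pos: "F 0 0 x t > 0" and G_pos: "G 0 0 x t > 0" if "t \<ge> 0" for x t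
    using that assms(3,4) F G by simp_all

  have evolution:
    "F 0 1 x t = - F 0 0 x t * (warped_product.v_ss (\<lambda>x. F 0 0 x t) (\<lambda>x. F 1 0 x t)
       (\<lambda>x. G 1 0 x t) (\<lambda>x. G 2 0 x t) x / G 0 0 x t)\<^sup>2" (is "_ = - _ * (?q / _)\<^sup>2")
    "G 0 1 x t = (1 - (warped_product.v_s (\<lambda>x. F 0 0 x t) (\<lambda>x. G 1 0 x t) x)\<^sup>2) *
       warped_product.v_ss (\<lambda>x. F 0 0 x t) (\<lambda>x. F 1 0 x t)
       (\<lambda>x. G 1 0 x t) (\<lambda>x. G 2 0 x t) x / (G 0 0 x t)\<^sup>2" (is "_ = (1 - ?w\<^sup>2) * _ / _")
    if t: "t \<ge> 0" for x t
  proof -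
    interpret warped_product "\<lambda>x. F 0 0 x t" "\<lambda>x. F 1 0 x t" "\<lambda>x. F 2 0 x t"
      "\<lambda>x. G 0 0 x t" "\<lambda>x. G 1 0 x t" "\<lambda>x. G 2 0 x t"
      using t F_pos G_pos F_x[of t 0 0] F_x[of t 1 0] G_x[of t 0 0] G_x[of t 1 0]
      by unfold_locales (simp_all add: numeral_2_eq_2)
    have metric: "warped_metric f g t = metric"
      by (simp add: fun_eq_iff warped_metric_def metric_def diag3_def vec_eq_iff F[OF t, symmetric] G[OF t, symmetric])
    \<comment> \<open>The flow equations for the components \<open>(1,1)\<close> and \<open>(2,2)\<close> at a point of the equator.\<close>
    define p :: "real^3" where "p = (\<chi> i. if i = 1 then x else 0)"
    have p: "p $ 1 = x" "p $ 2 = 0" by (simp_all add: p_def)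
    have dom: "p \<in> chart_domain" by (simp add: chart_domain_def p)
    have flow: "((\<lambda>\<tau>. warped_metric f g \<tau> p $ i $ i) has_real_derivative
        - 2 * cross_curvature metric p $ i $ i) (at t within {0..})" for i
      using assms(5) t dom unfolding cross_curvature_flow_on_def metric[symmetric] by blast
    have square: "((\<lambda>\<tau>. (F 0 0 x \<tau>)\<^sup>2) has_real_derivative 2 * F 0 0 x t * F 0 1 x t) (at t within {0..})"
      "((\<lambda>\<tau>. (G 0 0 x \<tau>)\<^sup>2) has_real_derivative 2 * G 0 0 x t * G 0 1 x t) (at t within {0..})"
      using F_t[OF t, of 0 0 x] G_t[OF t, of 0 0 x] by (auto intro!: derivative_eq_intros)
    have "((\<lambda>\<tau>. (F 0 0 x \<tau>)\<^sup>2) has_real_derivative - 2 * cross_curvature metric p $ 1 $ 1)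
        (at t within {0..})"
      by (rule has_field_derivative_transform_within[OF flow[of 1] zero_less_one])
         (use t in \<open>simp_all add: warped_metric_def p F\<close>)
    from one_sided_derivative_unique[OF t square(1) this]
    have "2 * F 0 0 x t * F 0 1 x t = 2 * F 0 0 x t * (- F 0 0 x t * (?q / G 0 0 x t)\<^sup>2)"
      by (simp add: cross_curvature_eq[OF dom] p power2_eq_square)
    then show "F 0 1 x t = - F 0 0 x t * (?q / G 0 0 x t)\<^sup>2"
      using F_pos[OF t, of x] by (subst (asm) mult_left_cancel) auto
    have "((\<lambda>\<tau>. (G 0 0 x \<tau>)\<^sup>2) has_real_derivative - 2 * cross_curvature metric p $ 2 $ 2)
        (at t within {0..})"
      by (rule has_field_derivative_transform_within[OF flow[of 2] zero_less_one])
         (use t in \<open>simp_all add: warped_metric_def p G\<close>)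
    from one_sided_derivative_unique[OF t square(2) this]
    have "2 * G 0 0 x t * G 0 1 x t = 2 * G 0 0 x t * ((1 - ?w\<^sup>2) * ?q / (G 0 0 x t)\<^sup>2)"
      using G_pos[OF t, of x]
      by (simp add: cross_curvature_eq[OF dom] p power2_eq_square) (simp add: divide_simps algebra_simps)
    then show "G 0 1 x t = (1 - ?w\<^sup>2) * ?q / (G 0 0 x t)\<^sup>2"
      using G_pos[OF t, of x] by (subst (asm) mult_left_cancel) auto
  qed

  have "cross_curvature_profile (2 * pi) (F 0 0) (F 1 0) (F 2 0) (F 0 1) (G 0 0) (G 1 0) (G 2 0) (G 0 1)"
  proof
    fix x t :: real assume t: "t \<ge> 0"
    show "F 0 0 (x + 2 * pi) t = F 0 0 x t" "G 0 0 (x + 2 * pi) t = G 0 0 x t"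
      by (simp_all only: F[OF t] G[OF t] cis_period)
  qed (use evolution F_pos G_pos F_cont G_cont F_x[of _ 0 0] F_x[of _ 1 0] G_x[of _ 0 0] G_x[of _ 1 0]
      F_t[of _ 0 0] G_t[of _ 0 0] in \<open>simp_all add: numeral_2_eq_2\<close>)
  then obtain \<alpha> where \<alpha>: "\<alpha> > 0"
    "\<And>e. e > 0 \<Longrightarrow> \<exists>T\<ge>0. \<forall>t\<ge>T. \<forall>x. \<bar>G 0 0 x t - \<alpha>\<bar> < e"
    using cross_curvature_profile.converges_to_constant by blast
  have "uniform_limit (sphere 0 1) (\<lambda>t w. g w t) (\<lambda>_. \<alpha>) at_top"
    unfolding uniform_limit_iff
  proof (intro allI impI)
    fix e :: real assume "e > 0"
    from \<alpha>(2)[OF this] obtain T where T: "T \<ge> 0" "\<forall>t\<ge>T. \<forall>x. \<bar>G 0 0 x t - \<alpha>\<bar> < e" by blast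
    have "dist (g w t) \<alpha> < e" if w: "w \<in> sphere 0 1" and t: "t \<ge> T" for w t
    proof -
      have "norm w = 1" using w by simp
      then have "cis (Arg w) = w"
        using cis_Arg[of w] by (cases "w = 0") (simp_all add: sgn_div_norm)
      then have "g w t = G 0 0 (Arg w) t" using G[of t "Arg w"] t T(1) by simp
      then show ?thesis using T(2) t by (simp add: dist_real_def)
    qed
    then show "\<forall>\<^sub>F t in at_top. \<forall>w\<in>sphere 0 1. dist (g w t) \<alpha> < e"
      unfolding eventually_at_top_linorder by blast
  qed
  with \<alpha>(1) show ?thesis by blast
qed

end
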